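(* Let $G$ and $H$ be non-trivial finitely generated groups. Let $C$ be a left-relatively convex proper subgroup of the free product $G*H$. If $C$ is finitely generated, then no left-preorder on $G*H$ relative to $C$ has a positive cone $P$ that is finitely generated as a subsemigroup.
   Context: A left-preorder on a group $\Gamma$ is a total, transitive, reflexive binary relation $\preceq$ on $\Gamma$ that is left-invariant ($g_1\preceq g_2$ implies $gg_1\preceq gg_2$) and non-trivial (not all pairs are related). For a left-preorder $\preceq$, the set $C=\{g: g\preceq 1 \text{ and } 1\preceq g\}$ is a proper subgroup of $\Gamma$, and $\preceq$ is said to be a left-preorder on $\Gamma$ relative to $C$; its positive cone is $P=\{g\in\Gamma: 1\preceq g,\ g\notin C\}$, which is a subsemigroup with $\Gamma=P\sqcup P^{-1}\sqcup C$. A proper subgroup $C$ of $\Gamma$ is left-relatively convex on $\Gamma$ if there exists a left-preorder on $\Gamma$ relative to $C$. *)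

theory Defs
  imports "HOL-Algebra.Algebra"
begin

section \<open>Free products\<close>

text \<open>
  The free product is the group of reduced words: alternating words in the non-identity elements
  of the two factors. Words are multiplied by prepending the letters of the first one to the
  second one, last letter first, and merging adjacent letters from the same factor.
\<close>

definition reduced_words ::
  "('a, 'm) monoid_scheme \<Rightarrow> ('b, 'n) monoid_scheme \<Rightarrow> ('a + 'b) list set"
  where "reduced_words G H =
    {w. set w \<subseteq> Inl ` (carrier G - {\<one>\<^bsub>G\<^esub>}) \<union> Inr ` (carrier H - {\<one>\<^bsub>H\<^esub>}) \<and>
        successively (\<lambda>s t. isl s \<noteq> isl t) w}"

fun prepend ::
  "('a, 'm) monoid_scheme \<Rightarrow> ('b, 'n) monoid_scheme \<Rightarrow> 'a + 'b \<Rightarrow> ('a + 'b) list \<Rightarrow> ('a + 'b) list"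
  where
    "prepend G H (Inl x) (Inl y # w) =
      (if x \<otimes>\<^bsub>G\<^esub> y = \<one>\<^bsub>G\<^esub> then w else Inl (x \<otimes>\<^bsub>G\<^esub> y) # w)"
  | "prepend G H (Inr x) (Inr y # w) =
      (if x \<otimes>\<^bsub>H\<^esub> y = \<one>\<^bsub>H\<^esub> then w else Inr (x \<otimes>\<^bsub>H\<^esub> y) # w)"
  | "prepend G H (Inl x) w = (if x = \<one>\<^bsub>G\<^esub> then w else Inl x # w)"
  | "prepend G H (Inr x) w = (if x = \<one>\<^bsub>H\<^esub> then w else Inr x # w)"

definition free_product ::
  "('a, 'm) monoid_scheme \<Rightarrow> ('b, 'n) monoid_scheme \<Rightarrow> ('a + 'b) list monoid"
  where "free_product G H =
    \<lparr>carrier = reduced_words G H, monoid.mult = foldr (prepend G H), one = []\<rparr>"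

context
  fixes G :: "('a, 'm) monoid_scheme" and H :: "('b, 'n) monoid_scheme"
  assumes G: "group G" and H: "group H"
begin

interpretation G: group G by (rule G)
interpretation H: group H by (rule H)

lemma reduced_words_Nil: "[] \<in> reduced_words G H"
  by (simp add: reduced_words_def)

lemma reduced_words_Cons:
  "s # w \<in> reduced_words G H \<longleftrightarrow>
    s \<in> Inl ` (carrier G - {\<one>\<^bsub>G\<^esub>}) \<union> Inr ` (carrier H - {\<one>\<^bsub>H\<^esub>}) \<and> w \<in> reduced_words G H \<and>
    (w = [] \<or> isl s \<noteq> isl (hd w))"
  by (cases w) (auto simp: reduced_words_def)

lemma prepend_closed:
  assumes "s \<in> Inl ` carrier G \<union> Inr ` carrier H" "w \<in> reduced_words G H"
  shows "prepend G H s w \<in> reduced_words G H"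
  using assms by (cases s; cases w; cases "hd w") (auto simp: reduced_words_Cons)

lemma prepend_one:
  assumes "w \<in> reduced_words G H"
  shows "prepend G H (Inl \<one>\<^bsub>G\<^esub>) w = w" "prepend G H (Inr \<one>\<^bsub>H\<^esub>) w = w"
  using assms by (cases w; cases "hd w"; auto simp: reduced_words_Cons)+

lemma prepend_prepend_Inl:
  assumes "x \<in> carrier G" "y \<in> carrier G" "w \<in> reduced_words G H"
  shows "prepend G H (Inl x) (prepend G H (Inl y) w) = prepend G H (Inl (x \<otimes>\<^bsub>G\<^esub> y)) w"
proof (cases w)
  case Nil
  then show ?thesis using assms by auto
next
  case (Cons s v)
  show ?thesis
  proof (cases s)
    case (Inr z)
    then show ?thesis using assms Cons by auto
  next
    case (Inl z)
    have z: "z \<in> carrier G" "z \<noteq> \<one>\<^bsub>G\<^esub>" and v: "v \<in> reduced_words G H" "v = [] \<or> \<not> isl (hd v)"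
      using assms(3) Cons Inl by (auto simp: reduced_words_Cons)
    have nm: "prepend G H (Inl a) v = (if a = \<one>\<^bsub>G\<^esub> then v else Inl a # v)" for a
      using v(2) by (cases v; cases "hd v") auto
    show ?thesis
    proof (cases "y \<otimes>\<^bsub>G\<^esub> z = \<one>\<^bsub>G\<^esub>")
      case True
      then have "x \<otimes>\<^bsub>G\<^esub> y \<otimes>\<^bsub>G\<^esub> z = x" using assms z by (simp add: G.m_assoc)
      then show ?thesis using True Cons Inl nm by simp
    next
      case False
      then show ?thesis using Cons Inl assms z by (simp add: G.m_assoc)
    qed
  qed
qed

lemma prepend_prepend_Inr:
  assumes "x \<in> carrier H" "y \<in> carrier H" "w \<in> reduced_words G H"
  shows "prepend G H (Inr x) (prepend G H (Inr y) w) = prepend G H (Inr (x \<otimes>\<^bsub>H\<^esub> y)) w"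
proof (cases w)
  case Nil
  then show ?thesis using assms by auto
next
  case (Cons s v)
  show ?thesis
  proof (cases s)
    case (Inl z)
    then show ?thesis using assms Cons by auto
  next
    case (Inr z)
    have z: "z \<in> carrier H" "z \<noteq> \<one>\<^bsub>H\<^esub>" and v: "v \<in> reduced_words G H" "v = [] \<or> isl (hd v)"
      using assms(3) Cons Inr by (auto simp: reduced_words_Cons)
    have nm: "prepend G H (Inr a) v = (if a = \<one>\<^bsub>H\<^esub> then v else Inr a # v)" for a
      using v(2) by (cases v; cases "hd v") auto
    show ?thesis
    proof (cases "y \<otimes>\<^bsub>H\<^esub> z = \<one>\<^bsub>H\<^esub>")
      case True
      then have "x \<otimes>\<^bsub>H\<^esub> y \<otimes>\<^bsub>H\<^esub> z = x" using assms z by (simp add: H.m_assoc)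
      then show ?thesis using True Cons Inr nm by simp
    next
      case False
      then show ?thesis using Cons Inr assms z by (simp add: H.m_assoc)
    qed
  qed
qed

lemma prepend_reduced:
  assumes "s # w \<in> reduced_words G H"
  shows "prepend G H s w = s # w"
  using assms by (cases s; cases w; cases "hd w") (auto simp: reduced_words_Cons)

lemma foldr_prepend_closed:
  assumes "u \<in> reduced_words G H" "v \<in> reduced_words G H"
  shows "foldr (prepend G H) u v \<in> reduced_words G H"
  using assms by (induction u) (auto simp: reduced_words_Cons intro!: prepend_closed)

lemma foldr_prepend_Nil:
  assumes "u \<in> reduced_words G H"
  shows "foldr (prepend G H) u [] = u"
  using assms
proof (induction u)
  case (Cons s u)
  then show ?case using prepend_reduced[of s u] by (simp add: reduced_words_Cons)
qed simp

lemma foldr_prepend_prepend: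
  assumes "s \<in> Inl ` carrier G \<union> Inr ` carrier H" "u \<in> reduced_words G H" "v \<in> reduced_words G H"
  shows "foldr (prepend G H) (prepend G H s u) v = prepend G H s (foldr (prepend G H) u v)"
proof -
  have *: "foldr (prepend G H) u' v \<in> reduced_words G H" if "u' \<in> reduced_words G H" for u'
    using foldr_prepend_closed that assms(3) by blast
  have **: "prepend G H t (foldr (prepend G H) u' v) \<in> reduced_words G H"
    if "t \<in> Inl ` carrier G \<union> Inr ` carrier H" "u' \<in> reduced_words G H" for t u'
    using that * prepend_closed by blast
  show ?thesis
    using assms
    by (cases s; cases u; cases "hd u")
       (auto simp: reduced_words_Cons prepend_prepend_Inl prepend_prepend_Inr prepend_one * **
          prepend_closed[OF _ assms(3)])
qed

lemma foldr_prepend_assoc: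
  assumes "u \<in> reduced_words G H" "v \<in> reduced_words G H" "w \<in> reduced_words G H"
  shows "foldr (prepend G H) (foldr (prepend G H) u v) w =
    foldr (prepend G H) u (foldr (prepend G H) v w)"
  using assms
proof (induction u)
  case (Cons s u)
  then show ?case
    by (auto simp: reduced_words_Cons foldr_prepend_prepend foldr_prepend_closed)
qed simp

lemma foldr_prepend_left_inverse:
  assumes "u \<in> reduced_words G H"
  shows "\<exists>v \<in> reduced_words G H. foldr (prepend G H) v u = []"
  using assms
proof (induction u)
  case Nil
  show ?case by (rule bexI[of _ "[]"]) (simp_all add: reduced_words_Nil)
next
  case (Cons s u)
  then have u: "u \<in> reduced_words G H" by (simp add: reduced_words_Cons)
  with Cons.IH obtain v where v: "v \<in> reduced_words G H" "foldr (prepend G H) v u = []" by blast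
  obtain t where t: "[t] \<in> reduced_words G H" "prepend G H t (s # u) = u"
  proof (cases s)
    case (Inl x)
    with Cons.prems show ?thesis
      by (intro that[of "Inl (inv\<^bsub>G\<^esub> x)"]) (auto simp: reduced_words_Cons reduced_words_Nil)
  next
    case (Inr x)
    with Cons.prems show ?thesis
      by (intro that[of "Inr (inv\<^bsub>H\<^esub> x)"]) (auto simp: reduced_words_Cons reduced_words_Nil)
  qed
  have "foldr (prepend G H) (foldr (prepend G H) v [t]) (s # u) = []"
    using v t Cons.prems by (subst foldr_prepend_assoc) auto
  with v t show ?case using foldr_prepend_closed by blast
qed

theorem group_free_product: "group (free_product G H)"
proof (rule groupI)
  fix u v w
  assume "u \<in> carrier (free_product G H)" "v \<in> carrier (free_product G H)"
    and "w \<in> carrier (free_product G H)"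
  then show "u \<otimes>\<^bsub>free_product G H\<^esub> v \<otimes>\<^bsub>free_product G H\<^esub> w =
      u \<otimes>\<^bsub>free_product G H\<^esub> (v \<otimes>\<^bsub>free_product G H\<^esub> w)"
    unfolding free_product_def by (simp only: monoid.simps partial_object.simps foldr_prepend_assoc)
next
  fix u
  assume "u \<in> carrier (free_product G H)"
  then show "\<exists>v\<in>carrier (free_product G H).
      v \<otimes>\<^bsub>free_product G H\<^esub> u = \<one>\<^bsub>free_product G H\<^esub>"
    unfolding free_product_def
    by (simp only: monoid.simps partial_object.simps foldr_prepend_left_inverse)
next
  fix u v
  assume "u \<in> carrier (free_product G H)" "v \<in> carrier (free_product G H)"
  then show "u \<otimes>\<^bsub>free_product G H\<^esub> v \<in> carrier (free_product G H)"
    unfolding free_product_def by (simp only: monoid.simps partial_object.simps foldr_prepend_closed)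
next
  show "\<one>\<^bsub>free_product G H\<^esub> \<in> carrier (free_product G H)"
    by (simp add: free_product_def reduced_words_Nil)
next
  fix u
  show "\<one>\<^bsub>free_product G H\<^esub> \<otimes>\<^bsub>free_product G H\<^esub> u = u"
    by (simp add: free_product_def)
qed

lemma free_product_inclusions:
  "(\<lambda>x. prepend G H (Inl x) []) \<in> hom G (free_product G H)"
  "(\<lambda>y. prepend G H (Inr y) []) \<in> hom H (free_product G H)"
proof -
  have "Inl x \<in> Inl ` carrier G \<union> Inr ` carrier H" if "x \<in> carrier G" for x using that by auto
  moreover have "Inr y \<in> Inl ` carrier G \<union> Inr ` carrier H" if "y \<in> carrier H" for y using that by auto
  ultimately show "(\<lambda>x. prepend G H (Inl x) []) \<in> hom G (free_product G H)"
    "(\<lambda>y. prepend G H (Inr y) []) \<in> hom H (free_product G H)"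
    by (auto simp: hom_def free_product_def prepend_closed reduced_words_Nil
        foldr_prepend_prepend prepend_prepend_Inl prepend_prepend_Inr
        simp del: prepend.simps)
qed

theorem free_product_universal:
  fixes K :: "('c, 'k) monoid_scheme"
  assumes K: "group K" and \<phi>: "\<phi> \<in> hom G K" and \<psi>: "\<psi> \<in> hom H K"
  shows "\<exists>!\<theta>. \<theta> \<in> hom (free_product G H) K \<and> \<theta> \<in> extensional (carrier (free_product G H)) \<and>
    (\<forall>x\<in>carrier G. \<theta> (prepend G H (Inl x) []) = \<phi> x) \<and>
    (\<forall>y\<in>carrier H. \<theta> (prepend G H (Inr y) []) = \<psi> y)"
    (is "\<exists>!\<theta>. ?P \<theta>")
proof -
  interpret K: group K by (rule K)
  interpret F: group "free_product G H" by (rule group_free_product)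
  interpret \<phi>: group_hom G K \<phi> using \<phi> by unfold_locales
  interpret \<psi>: group_hom H K \<psi> using \<psi> by unfold_locales
  define e where "e s = case_sum \<phi> \<psi> s" for s
  have e_simps: "e (Inl x) = \<phi> x" "e (Inr y) = \<psi> y" for x y by (simp_all add: e_def)
  define f where "f w = foldr (\<lambda>s z. e s \<otimes>\<^bsub>K\<^esub> z) w \<one>\<^bsub>K\<^esub>" for w
  have f_simps: "f [] = \<one>\<^bsub>K\<^esub>" "f (s # w) = e s \<otimes>\<^bsub>K\<^esub> f w" for s w by (simp_all add: f_def)
  have e_closed: "e s \<in> carrier K" if "s \<in> Inl ` carrier G \<union> Inr ` carrier H" for s
    using that by (auto simp: e_simps)
  have letters: "s \<in> Inl ` carrier G \<union> Inr ` carrier H" if "s # w \<in> reduced_words G H" for s w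
    using that by (auto simp: reduced_words_Cons)
  have f_closed: "f w \<in> carrier K" if "w \<in> reduced_words G H" for w
    using that
  proof (induction w)
    case (Cons s w)
    then show ?case using letters[OF Cons.prems] e_closed[of s]
      by (simp add: f_simps reduced_words_Cons)
  qed (simp add: f_simps)
  have f_prepend: "f (prepend G H s w) = e s \<otimes>\<^bsub>K\<^esub> f w"
    if "s \<in> Inl ` carrier G \<union> Inr ` carrier H" "w \<in> reduced_words G H" for s w
  proof -
    have \<phi>_assoc: "\<phi> x \<otimes>\<^bsub>K\<^esub> (\<phi> y \<otimes>\<^bsub>K\<^esub> z) = \<phi> (x \<otimes>\<^bsub>G\<^esub> y) \<otimes>\<^bsub>K\<^esub> z"
      if "x \<in> carrier G" "y \<in> carrier G" "z \<in> carrier K" for x y z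
      using that by (simp add: K.m_assoc)
    have \<psi>_assoc: "\<psi> x \<otimes>\<^bsub>K\<^esub> (\<psi> y \<otimes>\<^bsub>K\<^esub> z) = \<psi> (x \<otimes>\<^bsub>H\<^esub> y) \<otimes>\<^bsub>K\<^esub> z"
      if "x \<in> carrier H" "y \<in> carrier H" "z \<in> carrier K" for x y z
      using that by (simp add: K.m_assoc)
    show ?thesis
      using that
      by (cases s; cases w; cases "hd w")
         (auto simp: reduced_words_Cons f_simps f_closed e_simps \<phi>_assoc \<psi>_assoc
            simp flip: \<phi>.hom_mult \<psi>.hom_mult)
  qed
  have f_hom: "f (foldr (prepend G H) u v) = f u \<otimes>\<^bsub>K\<^esub> f v"
    if "u \<in> reduced_words G H" "v \<in> reduced_words G H" for u v
    using that
  proof (induction u)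
    case (Cons s u)
    then show ?case using letters[OF Cons.prems(1)] f_closed e_closed
      by (simp add: f_simps f_prepend foldr_prepend_closed reduced_words_Cons K.m_assoc)
  qed (simp add: f_simps f_closed)
  define \<theta> where "\<theta> = restrict f (reduced_words G H)"
  show ?thesis
  proof (rule ex1I[of _ \<theta>])
    have "\<theta> \<in> hom (free_product G H) K"
      by (auto simp: hom_def \<theta>_def free_product_def f_hom f_closed foldr_prepend_closed)
    moreover have \<theta>_letter: "\<theta> (prepend G H s []) = e s"
      if "s \<in> Inl ` carrier G \<union> Inr ` carrier H" for s
      using that by (simp add: \<theta>_def prepend_closed reduced_words_Nil f_prepend f_simps e_closed
          del: prepend.simps)
    have "\<theta> (prepend G H (Inl x) []) = \<phi> x" if "x \<in> carrier G" for x
      using \<theta>_letter[of "Inl x"] that by (simp add: e_simps del: prepend.simps)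
    moreover have "\<theta> (prepend G H (Inr y) []) = \<psi> y" if "y \<in> carrier H" for y
      using \<theta>_letter[of "Inr y"] that by (simp add: e_simps del: prepend.simps)
    ultimately show "?P \<theta>" by (auto simp: \<theta>_def free_product_def simp del: prepend.simps)
  next
    fix \<eta> assume \<eta>: "?P \<eta>"
    then interpret \<eta>: group_hom "free_product G H" K \<eta> by unfold_locales auto
    have "\<eta> w = f w" if "w \<in> reduced_words G H" for w
      using that
    proof (induction w)
      case Nil
      then show ?case using \<eta>.hom_one by (simp add: free_product_def f_simps)
    next
      case (Cons s w)
      then have w: "w \<in> carrier (free_product G H)" and s: "[s] \<in> carrier (free_product G H)"
        by (auto simp: free_product_def reduced_words_Cons reduced_words_Nil)
      have "s # w = [s] \<otimes>\<^bsub>free_product G H\<^esub> w"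
        using prepend_reduced[OF Cons.prems] by (simp add: free_product_def)
      then have "\<eta> (s # w) = \<eta> [s] \<otimes>\<^bsub>K\<^esub> \<eta> w" using \<eta>.hom_mult[OF s w] by simp
      moreover have "\<eta> [s] = e s"
      proof (cases s)
        case (Inl x)
        then show ?thesis
          using Cons.prems bspec[OF conjunct1[OF conjunct2[OF conjunct2[OF \<eta>]]], of x]
          by (auto simp: reduced_words_Cons e_simps split: if_splits)
      next
        case (Inr y)
        then show ?thesis
          using Cons.prems bspec[OF conjunct2[OF conjunct2[OF conjunct2[OF \<eta>]]], of y]
          by (auto simp: reduced_words_Cons e_simps split: if_splits)
      qed
      ultimately show ?case using Cons by (simp add: f_simps reduced_words_Cons)
    qed
    then show "\<eta> = \<theta>"
      using \<eta> by (intro extensionalityI[of _ "reduced_words G H"])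
        (auto simp: \<theta>_def free_product_def)
  qed
qed

end


section \<open>Left-preorders\<close>

definition left_preorder :: "('a, 'm) monoid_scheme \<Rightarrow> 'a rel \<Rightarrow> bool"
  where "left_preorder \<Gamma> r \<longleftrightarrow>
    r \<subseteq> carrier \<Gamma> \<times> carrier \<Gamma> \<and>
    refl_on (carrier \<Gamma>) r \<and> trans r \<and> total_on (carrier \<Gamma>) r \<and>
    (\<forall>g\<in>carrier \<Gamma>. \<forall>(x, y)\<in>r. (g \<otimes>\<^bsub>\<Gamma>\<^esub> x, g \<otimes>\<^bsub>\<Gamma>\<^esub> y) \<in> r) \<and>
    r \<noteq> carrier \<Gamma> \<times> carrier \<Gamma>"

definition preorder_kernel :: "('a, 'm) monoid_scheme \<Rightarrow> 'a rel \<Rightarrow> 'a set"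
  where "preorder_kernel \<Gamma> r = {g \<in> carrier \<Gamma>. (g, \<one>\<^bsub>\<Gamma>\<^esub>) \<in> r \<and> (\<one>\<^bsub>\<Gamma>\<^esub>, g) \<in> r}"

definition left_preorder_relative_to :: "('a, 'm) monoid_scheme \<Rightarrow> 'a set \<Rightarrow> 'a rel \<Rightarrow> bool"
  where "left_preorder_relative_to \<Gamma> C r \<longleftrightarrow> left_preorder \<Gamma> r \<and> preorder_kernel \<Gamma> r = C"

definition positive_cone :: "('a, 'm) monoid_scheme \<Rightarrow> 'a rel \<Rightarrow> 'a set"
  where "positive_cone \<Gamma> r = {g \<in> carrier \<Gamma>. (\<one>\<^bsub>\<Gamma>\<^esub>, g) \<in> r \<and> g \<notin> preorder_kernel \<Gamma> r}"

definition left_relatively_convex :: "('a, 'm) monoid_scheme \<Rightarrow> 'a set \<Rightarrow> bool"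
  where "left_relatively_convex \<Gamma> C \<longleftrightarrow>
    subgroup C \<Gamma> \<and> C \<noteq> carrier \<Gamma> \<and> (\<exists>r. left_preorder_relative_to \<Gamma> C r)"


section \<open>Finite generation\<close>

definition fin_gen_subgroup :: "('a, 'm) monoid_scheme \<Rightarrow> 'a set \<Rightarrow> bool"
  where "fin_gen_subgroup \<Gamma> A \<longleftrightarrow> (\<exists>S. finite S \<and> S \<subseteq> carrier \<Gamma> \<and> generate \<Gamma> S = A)"

abbreviation fin_gen_group :: "('a, 'm) monoid_scheme \<Rightarrow> bool"
  where "fin_gen_group \<Gamma> \<equiv> fin_gen_subgroup \<Gamma> (carrier \<Gamma>)"

inductive_set subsemigroup_generated :: "('a, 'm) monoid_scheme \<Rightarrow> 'a set \<Rightarrow> 'a set"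
  for \<Gamma> and S
  where
    incl: "s \<in> S \<Longrightarrow> s \<in> subsemigroup_generated \<Gamma> S"
  | mult: "g \<in> subsemigroup_generated \<Gamma> S \<Longrightarrow> h \<in> subsemigroup_generated \<Gamma> S \<Longrightarrow>
      g \<otimes>\<^bsub>\<Gamma>\<^esub> h \<in> subsemigroup_generated \<Gamma> S"

definition fin_gen_subsemigroup :: "('a, 'm) monoid_scheme \<Rightarrow> 'a set \<Rightarrow> bool"
  where "fin_gen_subsemigroup \<Gamma> A \<longleftrightarrow>
    (\<exists>S. finite S \<and> S \<subseteq> carrier \<Gamma> \<and> subsemigroup_generated \<Gamma> S = A)"

end

theory Submission
  imports Defs
begin

text \<open>
  If the positive cone \<open>P\<close> is generated by a finite set \<open>S\<close>, then it is coarsely connected: any two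
  of its elements are joined inside \<open>P\<close> by a path with steps in a finite set. On the other hand,
  the set \<open>A\<close> of reduced words beginning with a letter of \<open>G\<close> has a coarse boundary that is finite:
  only finitely many elements of \<open>A\<close> leave \<open>A\<close> under right multiplication by one of finitely many
  elements. Translating far down in the order makes this boundary disjoint from \<open>P\<close>, so that the
  translate of \<open>A\<close> contains all of \<open>P\<close> or none of it. This is absurd, because both \<open>A\<close> and its
  complement are cofinal: they are exchanged, up to bounded error, by left translations, which
  preserve the order.
\<close>

section \<open>Strict cofinality and positive cones in left-preordered groups\<close>

text \<open>Strictness is required because the order may identify distinct elements: dividing
  \<open>u\<close> by \<open>y\<close> on the left must give an element of the positive cone, not of
  the kernel.\<close>

definition strictly_cofinal :: "('a, 'm) monoid_scheme \<Rightarrow> 'a rel \<Rightarrow> 'a set \<Rightarrow> bool"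
  where "strictly_cofinal \<Gamma> r A \<longleftrightarrow> (\<forall>y\<in>carrier \<Gamma>. \<exists>u\<in>A. (y, u) \<in> r \<and> (u, y) \<notin> r)"

lemma strictly_cofinal_mono:
  "strictly_cofinal \<Gamma> r A \<Longrightarrow> A \<subseteq> B \<Longrightarrow> strictly_cofinal \<Gamma> r B"
  unfolding strictly_cofinal_def by blast

context
  fixes \<Gamma> :: "('a, 'm) monoid_scheme" and r :: "'a rel"
  assumes group: "group \<Gamma>" and preorder: "left_preorder \<Gamma> r"
begin

interpretation group \<Gamma> by (rule group)

lemma left_preorder_total:
  "x \<in> carrier \<Gamma> \<Longrightarrow> y \<in> carrier \<Gamma> \<Longrightarrow> (x, y) \<in> r \<or> (y, x) \<in> r"
  using preorder unfolding left_preorder_def total_on_def refl_on_def by (cases "x = y") auto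

lemma left_preorder_trans: "(x, y) \<in> r \<Longrightarrow> (y, z) \<in> r \<Longrightarrow> (x, z) \<in> r"
  using preorder unfolding left_preorder_def trans_def by blast

lemma left_preorder_carrier: "(x, y) \<in> r \<Longrightarrow> x \<in> carrier \<Gamma> \<and> y \<in> carrier \<Gamma>"
  using preorder unfolding left_preorder_def by blast

lemma left_preorder_mult_iff:
  assumes "g \<in> carrier \<Gamma>" "x \<in> carrier \<Gamma>" "y \<in> carrier \<Gamma>"
  shows "(g \<otimes>\<^bsub>\<Gamma>\<^esub> x, g \<otimes>\<^bsub>\<Gamma>\<^esub> y) \<in> r \<longleftrightarrow> (x, y) \<in> r"
proof
  have inv: "(h \<otimes>\<^bsub>\<Gamma>\<^esub> a, h \<otimes>\<^bsub>\<Gamma>\<^esub> b) \<in> r" if "h \<in> carrier \<Gamma>" "(a, b) \<in> r" for h a b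
    using preorder that unfolding left_preorder_def by fast
  show "(x, y) \<in> r \<Longrightarrow> (g \<otimes>\<^bsub>\<Gamma>\<^esub> x, g \<otimes>\<^bsub>\<Gamma>\<^esub> y) \<in> r" using inv assms(1) .
  assume "(g \<otimes>\<^bsub>\<Gamma>\<^esub> x, g \<otimes>\<^bsub>\<Gamma>\<^esub> y) \<in> r"
  then show "(x, y) \<in> r" using inv[of "inv\<^bsub>\<Gamma>\<^esub> g" "g \<otimes>\<^bsub>\<Gamma>\<^esub> x" "g \<otimes>\<^bsub>\<Gamma>\<^esub> y"] assms by (simp flip: m_assoc)
qed

lemma mem_positive_cone_iff:
  "g \<in> positive_cone \<Gamma> r \<longleftrightarrow> g \<in> carrier \<Gamma> \<and> (\<one>\<^bsub>\<Gamma>\<^esub>, g) \<in> r \<and> (g, \<one>\<^bsub>\<Gamma>\<^esub>) \<notin> r"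
  by (auto simp: positive_cone_def preorder_kernel_def)

text \<open>Non-triviality and totality give some \<open>x\<close> strictly above some
  \<open>y\<close>; the left translation taking \<open>y\<close> to \<open>z\<close> then takes
  \<open>x\<close> strictly above \<open>z\<close>.\<close>

lemma strictly_cofinal_carrier: "strictly_cofinal \<Gamma> r (carrier \<Gamma>)"
  unfolding strictly_cofinal_def
proof
  fix z assume z: "z \<in> carrier \<Gamma>"
  obtain x y where xy: "x \<in> carrier \<Gamma>" "y \<in> carrier \<Gamma>" "(x, y) \<notin> r"
    using preorder unfolding left_preorder_def by auto
  define g where "g = z \<otimes>\<^bsub>\<Gamma>\<^esub> inv\<^bsub>\<Gamma>\<^esub> y"
  have g: "g \<in> carrier \<Gamma>" "g \<otimes>\<^bsub>\<Gamma>\<^esub> y = z" using z xy by (simp_all add: g_def m_assoc)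
  then show "\<exists>u\<in>carrier \<Gamma>. (z, u) \<in> r \<and> (u, z) \<notin> r"
    using left_preorder_mult_iff[of g x y] left_preorder_mult_iff[of g y x] xy
      left_preorder_total[of x y] by (intro bexI[of _ "g \<otimes>\<^bsub>\<Gamma>\<^esub> x"]) auto
qed

lemma finite_upper_bound:
  assumes "finite F" "F \<subseteq> carrier \<Gamma>"
  shows "\<exists>y\<in>carrier \<Gamma>. \<forall>f\<in>F. (f, y) \<in> r"
  using assms
proof (induction F)
  case (insert f F)
  then obtain y where y: "y \<in> carrier \<Gamma>" "\<forall>f\<in>F. (f, y) \<in> r" by auto
  show ?case
  proof (cases "(f, y) \<in> r")
    case False
    then have "(y, f) \<in> r" "(f, f) \<in> r" using left_preorder_total insert.prems y(1) by blast+
    with y insert.prems show ?thesis using left_preorder_trans by (intro bexI[of _ f]) auto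
  qed (use y in auto)
qed auto

text \<open>If \<open>y\<close> and \<open>z\<close> witness the failure for \<open>A\<close> and
  \<open>B\<close>, a common upper bound of the two witnesses the failure for the union.\<close>

lemma strictly_cofinal_Un:
  assumes "strictly_cofinal \<Gamma> r (A \<union> B)"
  shows "strictly_cofinal \<Gamma> r A \<or> strictly_cofinal \<Gamma> r B"
proof (rule ccontr)
  assume "\<not> ?thesis"
  then obtain y z where yz: "y \<in> carrier \<Gamma>" "z \<in> carrier \<Gamma>"
    "\<And>u. u \<in> A \<Longrightarrow> (y, u) \<in> r \<Longrightarrow> (u, y) \<in> r" "\<And>u. u \<in> B \<Longrightarrow> (z, u) \<in> r \<Longrightarrow> (u, z) \<in> r"
    unfolding strictly_cofinal_def by blast
  obtain w where w: "w \<in> carrier \<Gamma>" "(y, w) \<in> r" "(z, w) \<in> r"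
    using finite_upper_bound[of "{y, z}"] yz by auto
  then obtain u where "u \<in> A \<union> B" "(w, u) \<in> r" "(u, w) \<notin> r"
    using assms unfolding strictly_cofinal_def by blast
  then show False using w yz left_preorder_trans by blast
qed

lemma not_strictly_cofinal_finite:
  assumes "finite F" "F \<subseteq> carrier \<Gamma>"
  shows "\<not> strictly_cofinal \<Gamma> r F"
  using finite_upper_bound[OF assms] unfolding strictly_cofinal_def by blast

text \<open>Left multiplication by \<open>g\<close> is an automorphism of the preorder.\<close>

lemma strictly_cofinal_translate:
  assumes "strictly_cofinal \<Gamma> r A" "g \<in> carrier \<Gamma>"
  shows "strictly_cofinal \<Gamma> r ((\<otimes>\<^bsub>\<Gamma>\<^esub>) g ` A)"
  unfolding strictly_cofinal_def
proof
  fix y assume y: "y \<in> carrier \<Gamma>"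
  define z where "z = inv\<^bsub>\<Gamma>\<^esub> g \<otimes>\<^bsub>\<Gamma>\<^esub> y"
  have z: "z \<in> carrier \<Gamma>" "g \<otimes>\<^bsub>\<Gamma>\<^esub> z = y" using y assms(2) by (simp_all add: z_def flip: m_assoc)
  then obtain u where u: "u \<in> A" "(z, u) \<in> r" "(u, z) \<notin> r"
    using assms(1) unfolding strictly_cofinal_def by blast
  then have "u \<in> carrier \<Gamma>" using left_preorder_carrier by blast
  then show "\<exists>v\<in>(\<otimes>\<^bsub>\<Gamma>\<^esub>) g ` A. (y, v) \<in> r \<and> (v, y) \<notin> r"
    using u z assms(2) left_preorder_mult_iff[of g z u] left_preorder_mult_iff[of g u z] by auto
qed

text \<open>By left invariance, the elements strictly above \<open>y\<close> are exactly the
  products of \<open>y\<close> with positive elements.\<close>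

lemma strictly_cofinal_positive:
  assumes "strictly_cofinal \<Gamma> r A" "y \<in> carrier \<Gamma>"
  shows "\<exists>p\<in>positive_cone \<Gamma> r. y \<otimes>\<^bsub>\<Gamma>\<^esub> p \<in> A"
proof -
  obtain u where u: "u \<in> A" "(y, u) \<in> r" "(u, y) \<notin> r"
    using assms unfolding strictly_cofinal_def by blast
  then have "u \<in> carrier \<Gamma>" using left_preorder_carrier by blast
  define p where "p = inv\<^bsub>\<Gamma>\<^esub> y \<otimes>\<^bsub>\<Gamma>\<^esub> u"
  have p: "p \<in> carrier \<Gamma>" "y \<otimes>\<^bsub>\<Gamma>\<^esub> p = u"
    using \<open>u \<in> carrier \<Gamma>\<close> assms(2) by (simp_all add: p_def flip: m_assoc)
  then have "p \<in> positive_cone \<Gamma> r"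
    using u assms(2) left_preorder_mult_iff[of y p "\<one>\<^bsub>\<Gamma>\<^esub>"] left_preorder_mult_iff[of y "\<one>\<^bsub>\<Gamma>\<^esub>" p]
    by (simp add: mem_positive_cone_iff)
  then show ?thesis using p u by blast
qed

text \<open>The hypothesis \<open>finite_boundary\<close> says that \<open>A\<close> is an almost invariant set, so together with
  the cofinality assumptions \<open>\<Gamma>\<close> has more than one end.\<close>

lemma not_fin_gen_positive_cone:
  assumes A: "A \<subseteq> carrier \<Gamma>"
    and finite_boundary: "\<And>t. t \<in> carrier \<Gamma> \<Longrightarrow> finite {x \<in> A. x \<otimes>\<^bsub>\<Gamma>\<^esub> t \<notin> A}"
    and cofinal: "strictly_cofinal \<Gamma> r A" "strictly_cofinal \<Gamma> r (carrier \<Gamma> - A)"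
  shows "\<not> fin_gen_subsemigroup \<Gamma> (positive_cone \<Gamma> r)"
proof
  let ?P = "positive_cone \<Gamma> r"
  assume "fin_gen_subsemigroup \<Gamma> ?P"
  then obtain S where S: "finite S" "S \<subseteq> carrier \<Gamma>" "subsemigroup_generated \<Gamma> S = ?P"
    unfolding fin_gen_subsemigroup_def by blast
  define S' where "S' = insert \<one>\<^bsub>\<Gamma>\<^esub> S"
  \<comment> \<open>Since the identity is in \<open>S'\<close>, \<open>T\<close> contains every
    generator, so passing from \<open>p\<close> to a product of \<open>p\<close> with a generator is
    a step in \<open>T\<close>. The quotients of two generators join them directly, without passing
    through the identity, which is not in \<open>?P\<close>.\<close>
  define T where "T = (\<lambda>(a, b). inv\<^bsub>\<Gamma>\<^esub> a \<otimes>\<^bsub>\<Gamma>\<^esub> b) ` (S' \<times> S')"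
  have S': "S' \<subseteq> carrier \<Gamma>" using S by (auto simp: S'_def)
  have T: "finite T" "T \<subseteq> carrier \<Gamma>" using S S' by (auto simp: T_def S'_def)
  have T_mem: "inv\<^bsub>\<Gamma>\<^esub> a \<otimes>\<^bsub>\<Gamma>\<^esub> b \<in> T" if "a \<in> S'" "b \<in> S'" for a b
    using that unfolding T_def by auto
  have T_inv: "inv\<^bsub>\<Gamma>\<^esub> t \<in> T" if t: "t \<in> T" for t
  proof -
    obtain a b where ab: "a \<in> S'" "b \<in> S'" "t = inv\<^bsub>\<Gamma>\<^esub> a \<otimes>\<^bsub>\<Gamma>\<^esub> b"
      using t unfolding T_def by auto
    then have "a \<in> carrier \<Gamma>" "b \<in> carrier \<Gamma>" using S' by auto
    then show ?thesis using T_mem[OF ab(2,1)] ab(3) by (simp add: inv_mult_group)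
  qed
  define F where "F = (\<Union>t\<in>T. {x \<in> A. x \<otimes>\<^bsub>\<Gamma>\<^esub> t \<notin> A})"
  have "finite F" unfolding F_def using T(2) by (intro finite_UN_I[OF T(1)] finite_boundary) blast
  moreover have "F \<subseteq> carrier \<Gamma>" using A unfolding F_def by blast
  \<comment> \<open>Each product of \<open>y\<close> with a positive element is strictly above
    \<open>y\<close>, hence outside the boundary \<open>F\<close>.\<close>
  ultimately obtain y where y: "y \<in> carrier \<Gamma>" "\<And>f. f \<in> F \<Longrightarrow> (f, y) \<in> r"
    using finite_upper_bound[of F] by blast
  have P: "p \<in> carrier \<Gamma>" if "p \<in> ?P" for p using that by (simp add: mem_positive_cone_iff)
  have P_mult: "p \<otimes>\<^bsub>\<Gamma>\<^esub> q \<in> ?P" if "p \<in> ?P" "q \<in> ?P" for p q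
    using that subsemigroup_generated.mult[of p \<Gamma> S q] S(3) by simp
  have S_P: "s \<in> ?P" if "s \<in> S" for s using that subsemigroup_generated.incl[of s S \<Gamma>] S(3) by simp
  have stays: "y \<otimes>\<^bsub>\<Gamma>\<^esub> (p \<otimes>\<^bsub>\<Gamma>\<^esub> t) \<in> A" if "p \<in> ?P" "t \<in> T" "y \<otimes>\<^bsub>\<Gamma>\<^esub> p \<in> A" for p t
  proof (rule ccontr)
    assume "y \<otimes>\<^bsub>\<Gamma>\<^esub> (p \<otimes>\<^bsub>\<Gamma>\<^esub> t) \<notin> A"
    moreover have "t \<in> carrier \<Gamma>" using that(2) T(2) by blast
    ultimately have "y \<otimes>\<^bsub>\<Gamma>\<^esub> p \<otimes>\<^bsub>\<Gamma>\<^esub> t \<notin> A" using y(1) P[OF that(1)] by (simp add: m_assoc)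
    then have "y \<otimes>\<^bsub>\<Gamma>\<^esub> p \<in> F" using that unfolding F_def by blast
    then have "(y \<otimes>\<^bsub>\<Gamma>\<^esub> p, y) \<in> r" by (rule y(2))
    then show False
      using that(1) y(1) left_preorder_mult_iff[of y p "\<one>\<^bsub>\<Gamma>\<^esub>"] by (simp add: mem_positive_cone_iff)
  qed
  have step: "y \<otimes>\<^bsub>\<Gamma>\<^esub> q \<in> A \<longleftrightarrow> y \<otimes>\<^bsub>\<Gamma>\<^esub> p \<in> A"
    if "p \<in> ?P" "q \<in> ?P" "inv\<^bsub>\<Gamma>\<^esub> p \<otimes>\<^bsub>\<Gamma>\<^esub> q \<in> T" for p q
    using stays[of p "inv\<^bsub>\<Gamma>\<^esub> p \<otimes>\<^bsub>\<Gamma>\<^esub> q"] stays[of q "inv\<^bsub>\<Gamma>\<^esub> q \<otimes>\<^bsub>\<Gamma>\<^esub> p"]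
      T_inv[OF that(3)] that P[OF that(1)] P[OF that(2)]
    by (auto simp: inv_mult_group simp flip: m_assoc)
  \<comment> \<open>Walk from \<open>p\<close> along the generators of \<open>q\<close>. Keeping
    \<open>p\<close> arbitrary lets a product \<open>g\<close>, \<open>h\<close> be handled by
    moving the bracket: first from \<open>p\<close> along \<open>g\<close>, then from there along
    \<open>h\<close>.\<close>
  have mult: "y \<otimes>\<^bsub>\<Gamma>\<^esub> (p \<otimes>\<^bsub>\<Gamma>\<^esub> q) \<in> A \<longleftrightarrow> y \<otimes>\<^bsub>\<Gamma>\<^esub> p \<in> A"
    if "q \<in> subsemigroup_generated \<Gamma> S" "p \<in> ?P" for p q
    using that
  proof (induction arbitrary: p)
    case (incl s)
    have "inv\<^bsub>\<Gamma>\<^esub> p \<otimes>\<^bsub>\<Gamma>\<^esub> (p \<otimes>\<^bsub>\<Gamma>\<^esub> s) = inv\<^bsub>\<Gamma>\<^esub> \<one>\<^bsub>\<Gamma>\<^esub> \<otimes>\<^bsub>\<Gamma>\<^esub> s"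
      using P[OF incl(2)] P[OF S_P[OF incl(1)]] by (simp flip: m_assoc)
    then show ?case
      using incl P_mult S_P T_mem[of "\<one>\<^bsub>\<Gamma>\<^esub>" s] by (intro step) (auto simp: S'_def)
  next
    case (mult g h)
    then show ?case using S(3) P P_mult by (simp add: m_assoc[symmetric])
  qed
  obtain p where p: "p \<in> ?P" "y \<otimes>\<^bsub>\<Gamma>\<^esub> p \<in> A"
    using strictly_cofinal_positive[OF cofinal(1) y(1)] by blast
  obtain q where q: "q \<in> ?P" "y \<otimes>\<^bsub>\<Gamma>\<^esub> q \<notin> A"
    using strictly_cofinal_positive[OF cofinal(2) y(1)] by blast
  \<comment> \<open>By \<open>mult\<close>, a product may be cut down to its left factor, and so in
    the end to its first generator.\<close>
  have to_gen: "\<exists>s\<in>S. y \<otimes>\<^bsub>\<Gamma>\<^esub> x \<in> A \<longleftrightarrow> y \<otimes>\<^bsub>\<Gamma>\<^esub> s \<in> A" if "x \<in> subsemigroup_generated \<Gamma> S" for x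
    using that by induction (use mult S(3) in auto)
  obtain a b where "a \<in> S" "b \<in> S" "y \<otimes>\<^bsub>\<Gamma>\<^esub> a \<in> A" "y \<otimes>\<^bsub>\<Gamma>\<^esub> b \<notin> A"
    using to_gen[of p] to_gen[of q] p q S(3) by auto
  \<comment> \<open>The two generators differ by one element of \<open>T\<close>, so they cannot be
    separated by \<open>A\<close>.\<close>
  then show False using step[of a b] T_mem[of a b] S_P by (auto simp: S'_def)
qed

end

section \<open>Reduced words and the two cofinal halves of a free product\<close>

context
  fixes G :: "('a, 'm) monoid_scheme" and H :: "('b, 'n) monoid_scheme"
  assumes G: "group G" and H: "group H"
begin

text \<open>Folding a reduced word onto \<open>[]\<close> returns it; for \<open>u @ v\<close> that
  fold first builds \<open>v\<close> and then prepends \<open>u\<close>.\<close>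

lemma foldr_prepend_append:
  assumes "u @ v \<in> reduced_words G H"
  shows "foldr (prepend G H) u v = u @ v"
proof -
  have "v \<in> reduced_words G H"
    using assms by (auto simp: reduced_words_def successively_append_iff)
  then show ?thesis
    using foldr_prepend_Nil[OF G H assms] foldr_prepend_Nil[OF G H, of v] by simp
qed

lemma reduced_words_append:
  assumes "u \<in> reduced_words G H" "v \<in> reduced_words G H"
    and "u = [] \<or> v = [] \<or> isl (last u) \<noteq> isl (hd v)"
  shows "u @ v \<in> reduced_words G H"
  using assms by (auto simp: reduced_words_def successively_append_iff)

text \<open>Inversion reverses a word letter by letter, so the last letter of the inverse and the
  first letter of \<open>u\<close> come from the same factor. This is what excludes cancellation
  later on.\<close>

lemma reduced_left_inverse:
  assumes "u \<in> reduced_words G H" "u \<noteq> []"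
  shows "\<exists>v\<in>reduced_words G H. foldr (prepend G H) v u = [] \<and> v \<noteq> [] \<and> isl (last v) = isl (hd u)"
  using assms
proof (induction u)
  case (Cons s u)
  have u: "u \<in> reduced_words G H" using Cons.prems by (simp add: reduced_words_Cons[OF G H])
  \<comment> \<open>The last letter of \<open>v\<close>, if any, is in the other factor than
    \<open>s\<close>, so the inverse letter of \<open>s\<close> can be appended.\<close>
  obtain v where v: "v \<in> reduced_words G H" "foldr (prepend G H) v u = []"
    "v = [] \<or> isl (last v) \<noteq> isl s"
  proof (cases "u = []")
    case True
    then show ?thesis using that[of "[]"] by (simp add: reduced_words_Nil[OF G H])
  next
    case False
    then show ?thesis using Cons.IH[OF u] Cons.prems that by (auto simp: reduced_words_Cons[OF G H])
  qed
  obtain t where t: "[t] \<in> reduced_words G H" "prepend G H t (s # u) = u" "isl t = isl s"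
  proof (cases s)
    case (Inl x)
    with Cons.prems show ?thesis
      by (intro that[of "Inl (inv\<^bsub>G\<^esub> x)"])
        (auto simp: reduced_words_Cons[OF G H] reduced_words_Nil[OF G H] G
          group.l_inv group.inv_closed group.inv_eq_1_iff)
  next
    case (Inr x)
    with Cons.prems show ?thesis
      by (intro that[of "Inr (inv\<^bsub>H\<^esub> x)"])
        (auto simp: reduced_words_Cons[OF G H] reduced_words_Nil[OF G H] H
          group.l_inv group.inv_closed group.inv_eq_1_iff)
  qed
  have "v @ [t] \<in> reduced_words G H" using v t by (intro reduced_words_append) auto
  then show ?case using v t by (intro bexI[of _ "v @ [t]"]) auto
qed simp

text \<open>If \<open>x\<close> begins with a letter of \<open>G\<close> but \<open>x t\<close> does not, then nothing cancels in \<open>t = x\<inverse> (x t)\<close>,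
  so \<open>x\<inverse>\<close> is one of the finitely many prefixes of the reduced word \<open>t\<close>.\<close>

lemma finite_leaving_Inl_words:
  assumes t: "t \<in> carrier (free_product G H)"
  defines "A \<equiv> {x \<in> carrier (free_product G H). x \<noteq> [] \<and> isl (hd x)}"
  shows "finite {x \<in> A. x \<otimes>\<^bsub>free_product G H\<^esub> t \<notin> A}"
proof -
  let ?F = "free_product G H"
  interpret F: group ?F by (rule group_free_product[OF G H])
  have F_simps: "carrier ?F = reduced_words G H" "x \<otimes>\<^bsub>?F\<^esub> y = foldr (prepend G H) x y"
    "\<one>\<^bsub>?F\<^esub> = []" for x y
    by (simp_all add: free_product_def)
  have "{x \<in> A. x \<otimes>\<^bsub>?F\<^esub> t \<notin> A} \<subseteq> (\<lambda>k. inv\<^bsub>?F\<^esub> take k t) ` {..length t}"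
  proof
    fix x assume "x \<in> {x \<in> A. x \<otimes>\<^bsub>?F\<^esub> t \<notin> A}"
    then have x: "x \<in> carrier ?F" "x \<noteq> []" "isl (hd x)" and "x \<otimes>\<^bsub>?F\<^esub> t \<notin> A"
      by (auto simp: A_def)
    define w where "w = x \<otimes>\<^bsub>?F\<^esub> t"
    have w: "w \<in> carrier ?F" "w = [] \<or> \<not> isl (hd w)"
      using \<open>x \<otimes>\<^bsub>?F\<^esub> t \<notin> A\<close> x(1) t by (auto simp: w_def A_def)
    obtain v where v: "v \<in> carrier ?F" "v \<otimes>\<^bsub>?F\<^esub> x = \<one>\<^bsub>?F\<^esub>" "isl (last v)"
      using reduced_left_inverse[of x] x unfolding F_simps by auto
    have "t = v \<otimes>\<^bsub>?F\<^esub> w" using v x(1) t by (simp add: w_def F.m_assoc[symmetric])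
    \<comment> \<open>The word \<open>v\<close> ends in a letter of \<open>G\<close>, while
      \<open>w\<close> is empty or begins with a letter of \<open>H\<close>.\<close>
    moreover have "v @ w \<in> reduced_words G H"
      using v w by (intro reduced_words_append) (auto simp: F_simps)
    ultimately have "t = v @ w" by (simp add: F_simps(2) foldr_prepend_append)
    moreover have "x = inv\<^bsub>?F\<^esub> v" using F.inv_equality[OF v(2)] v(1) x(1) by (metis F.inv_inv)
    ultimately show "x \<in> (\<lambda>k. inv\<^bsub>?F\<^esub> take k t) ` {..length t}"
      by (intro image_eqI[of _ _ "length v"]) auto
  qed
  then show ?thesis by (rule finite_subset) simp
qed

text \<open>A ping-pong argument: \<open>A\<close>, \<open>B\<close> and the empty word cover the
  group, so \<open>A\<close> or \<open>B\<close> is strictly cofinal. A non-identity letter of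
  \<open>G\<close> translates \<open>B\<close> into \<open>A\<close>, and one of \<open>H\<close>
  translates \<open>A\<close> into \<open>B\<close>, which carries cofinality over to the other
  set.\<close>

lemma strictly_cofinal_Inl_Inr_words:
  assumes "carrier G \<noteq> {\<one>\<^bsub>G\<^esub>}" "carrier H \<noteq> {\<one>\<^bsub>H\<^esub>}" and r: "left_preorder (free_product G H) r"
  defines "A \<equiv> {x \<in> carrier (free_product G H). x \<noteq> [] \<and> isl (hd x)}"
    and "B \<equiv> {x \<in> carrier (free_product G H). x \<noteq> [] \<and> \<not> isl (hd x)}"
  shows "strictly_cofinal (free_product G H) r A \<and> strictly_cofinal (free_product G H) r B"
proof -
  let ?F = "free_product G H"
  note F = group_free_product[OF G H]
  interpret F: group ?F by (rule F)
  obtain g h where gh: "g \<in> carrier G" "g \<noteq> \<one>\<^bsub>G\<^esub>" "h \<in> carrier H" "h \<noteq> \<one>\<^bsub>H\<^esub>"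
    using assms(1,2) monoid.one_closed[OF group.is_monoid[OF G]]
      monoid.one_closed[OF group.is_monoid[OF H]] by blast
  have letters: "[Inl g] \<in> carrier ?F" "[Inr h] \<in> carrier ?F"
    using gh by (auto simp: free_product_def reduced_words_def)
  have "[Inl g] @ x \<in> A" "[Inl g] \<otimes>\<^bsub>?F\<^esub> x = [Inl g] @ x" if "x \<in> B" for x
  proof -
    show "[Inl g] @ x \<in> A"
      using that letters reduced_words_append[of "[Inl g]" x] by (auto simp: A_def B_def free_product_def)
    then show "[Inl g] \<otimes>\<^bsub>?F\<^esub> x = [Inl g] @ x"
      using foldr_prepend_append[of "[Inl g]" x] by (simp add: A_def free_product_def)
  qed
  then have BA: "(\<otimes>\<^bsub>?F\<^esub>) [Inl g] ` B \<subseteq> A" by auto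
  have "[Inr h] @ x \<in> B" "[Inr h] \<otimes>\<^bsub>?F\<^esub> x = [Inr h] @ x" if "x \<in> A" for x
  proof -
    show "[Inr h] @ x \<in> B"
      using that letters reduced_words_append[of "[Inr h]" x] by (auto simp: A_def B_def free_product_def)
    then show "[Inr h] \<otimes>\<^bsub>?F\<^esub> x = [Inr h] @ x"
      using foldr_prepend_append[of "[Inr h]" x] by (simp add: B_def free_product_def)
  qed
  then have AB: "(\<otimes>\<^bsub>?F\<^esub>) [Inr h] ` A \<subseteq> B" by auto
  have "[] \<in> carrier ?F" using F.one_closed by (simp add: free_product_def)
  then have "carrier ?F = (A \<union> B) \<union> {[]}" "\<not> strictly_cofinal ?F r {[]}"
    using not_strictly_cofinal_finite[OF F r, of "{[]}"] by (auto simp: A_def B_def)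
  then have "strictly_cofinal ?F r A \<or> strictly_cofinal ?F r B"
    using strictly_cofinal_carrier[OF F r] strictly_cofinal_Un[OF F r] by metis
  moreover have "strictly_cofinal ?F r B" if "strictly_cofinal ?F r A"
    using strictly_cofinal_mono[OF strictly_cofinal_translate[OF F r that letters(2)] AB] .
  moreover have "strictly_cofinal ?F r A" if "strictly_cofinal ?F r B"
    using strictly_cofinal_mono[OF strictly_cofinal_translate[OF F r that letters(1)] BA] .
  ultimately show ?thesis by blast
qed

end

theorem corollary1p7:
  fixes G :: "('a, 'm) monoid_scheme" and H :: "('b, 'n) monoid_scheme"
    and C :: "('a + 'b) list set"
  assumes "group G" and "group H"
    and "carrier G \<noteq> {\<one>\<^bsub>G\<^esub>}" and "carrier H \<noteq> {\<one>\<^bsub>H\<^esub>}"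
    and "fin_gen_group G" and "fin_gen_group H"
    and "left_relatively_convex (free_product G H) C"
    and "fin_gen_subgroup (free_product G H) C"
  shows "\<not> (\<exists>r. left_preorder_relative_to (free_product G H) C r \<and>
    fin_gen_subsemigroup (free_product G H) (positive_cone (free_product G H) r))"
proof (rule notI, elim exE conjE)
  fix r
  let ?F = "free_product G H"
  let ?A = "{x \<in> carrier ?F. x \<noteq> [] \<and> isl (hd x)}"
  let ?B = "{x \<in> carrier ?F. x \<noteq> [] \<and> \<not> isl (hd x)}"
  assume "left_preorder_relative_to ?F C r" and fin_gen: "fin_gen_subsemigroup ?F (positive_cone ?F r)"
  then have r: "left_preorder ?F r" by (simp add: left_preorder_relative_to_def)
  have cofinal: "strictly_cofinal ?F r ?A" "strictly_cofinal ?F r ?B"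
    using strictly_cofinal_Inl_Inr_words[OF assms(1-4) r] by simp_all
  have "strictly_cofinal ?F r (carrier ?F - ?A)"
    by (rule strictly_cofinal_mono[OF cofinal(2)]) auto
  with cofinal(1) have "\<not> fin_gen_subsemigroup ?F (positive_cone ?F r)"
    using finite_leaving_Inl_words[OF assms(1,2)]
    by (intro not_fin_gen_positive_cone[OF group_free_product[OF assms(1,2)] r, of ?A]) auto
  then show False using fin_gen by contradiction
qed

end
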